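(* Let $r,s\in SO(3)$ and $u,w\in\mathbb{R}^3$, let $r_1,r_2,r_3$ and $s_1,s_2,s_3$ be the column vectors of $r$ and $s$, and set $t_i=-r_i\otimes w+u\otimes s_i$ for $i=1,2,3$. Let $a_i$ be the classical adjoint (adjugate) of the $3\times3$ matrix $t_i$. Then for distinct $i,j,k\in\{1,2,3\}$: 1. $a_i=(s_i\wedge w)\otimes(r_i\wedge u)$; 2. $t_ia_i=(\det t_i)\,\mathrm{Id}=0$; 3. $t_ia_j=u\otimes(r_j\wedge u)\,\langle s_{\{i,j\}},w\rangle$; 4. $a_jt_i=-(s_j\wedge w)\otimes w\,\langle r_{\{i,j\}},u\rangle$; 5. $t_ia_jt_i=(u\otimes w)\,\langle s_{\{i,j\}},w\rangle\langle r_{\{j,i\}},u\rangle$; 6. $t_ia_jt_k=(u\otimes w)\,\langle s_{\{i,j\}},w\rangle\langle r_{\{j,k\}},u\rangle$; 7. $a_it_ja_k=0$.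
   Context: $x\otimes y$ denotes the $3\times 3$ matrix $xy^{t}$ for column vectors $x,y\in\mathbb{R}^3$; juxtaposition of matrices is matrix multiplication; $\langle\cdot,\cdot\rangle$ is the standard inner product; $\wedge$ is the cross product on $\mathbb{R}^3$ (under $\Lambda^2\mathbb{R}^3\cong\mathbb{R}^3$). The classical adjoint (adjugate) is the transpose of the matrix of cofactors. For $i\ne j$, $r_{\{i,j\}}:=r_i\wedge r_j=\pm r_k$, where $k$ is the index in $\{1,2,3\}$ different from $i,j$ and the sign is chosen so that $(r_i,r_j,\pm r_k)$ has the same orientation as $(r_1,r_2,r_3)$ (so $r_{\{j,i\}}=-r_{\{i,j\}}$); $s_{\{i,j\}}$ is defined similarly. The tensor $t=-r\otimes w+u\otimes s\in(\mathbb{R}^3)^{\otimes3}$ is the general Euclidean trifocal tensor, and $t_1,t_2,t_3$ are its slices with respect to the middle tensor factor. *)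

theory Defs
  imports "HOL-Analysis.Analysis"
begin

definition outer :: "real^3 \<Rightarrow> real^3 \<Rightarrow> real^3^3"
  where "outer x y = (columnvector x :: real^1^3) ** (rowvector y :: real^3^1)"

(* The increasing enumeration of the two indices other than i, for the order 1, 2, 3.
   It is written out case by case because the library order on the type 3 puts 3 (= 0) first. *)
definition other_index :: "3 \<Rightarrow> 2 \<Rightarrow> 3"
  where "other_index i k =
    (if k = 1 then (if i = 1 then 2 else 1) else (if i = 3 then 2 else 3))"

definition minor :: "real^3^3 \<Rightarrow> 3 \<Rightarrow> 3 \<Rightarrow> real"
  where "minor A i j = det (\<chi> k l. A $ other_index i k $ other_index j l)"

(* The sign is (-1)^(i+j): exactly the index 2 is even. *)
definition cofactor :: "real^3^3 \<Rightarrow> 3 \<Rightarrow> 3 \<Rightarrow> real"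
  where "cofactor A i j = (if (i = 2) = (j = 2) then 1 else - 1) * minor A i j"

definition adjugate :: "real^3^3 \<Rightarrow> real^3^3"
  where "adjugate A = transpose (\<chi> i j. cofactor A i j)"

definition column_wedge :: "real^3^3 \<Rightarrow> 3 \<Rightarrow> 3 \<Rightarrow> real^3"
  where "column_wedge r i j = cross3 (column i r) (column j r)"

lemma matrix_mul_adjugate: "A ** adjugate A = det A *\<^sub>R mat 1"
  by (simp add: vec_eq_iff forall_3 matrix_matrix_mult_def sum_3 adjugate_def transpose_def
      cofactor_def minor_def other_index_def det_2 det_3 mat_def algebra_simps)

lemma column_wedge_commute: "column_wedge r j i = - column_wedge r i j"
  unfolding column_wedge_def by (rule cross_skew)

(* For a rotation matrix, column_wedge r i j is plus or minus the third column of r, with the sign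
   that gives it the orientation of the columns of r. *)
lemma column_wedge_rotation:
  assumes "rotation_matrix r"
  shows "column_wedge r 1 2 = column 3 r" "column_wedge r 2 3 = column 1 r"
    "column_wedge r 3 1 = column 2 r"
proof -
  have c: "column i r = r *v axis i 1" for i
    by (simp add: matrix_vector_mul_component column_def matrix_vector_mult_basis)
  show "column_wedge r 1 2 = column 3 r" "column_wedge r 2 3 = column 1 r"
    "column_wedge r 3 1 = column 2 r"
    unfolding column_wedge_def c cross_rotation_matrix[OF assms]
    by (simp_all add: cross_basis)
qed

end

theory Submission
  imports Defs
begin

text \<open>
  Each slice has rank at most two, so its adjugate is the single outer product of the two cross
  products that annihilate it from either side. Every product of slices and adjugates then
  contracts to outer products with scalar triple products as coefficients.
\<close>

lemma outer_component [simp]: "outer x y $ i $ j = x $ i * y $ j"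
  by (simp add: outer_def matrix_matrix_mult_def columnvector_def rowvector_def)

lemma outer_mult_outer: "outer a b ** outer c d = (b \<bullet> c) *\<^sub>R outer a d"
  by (simp add: vec_eq_iff matrix_matrix_mult_def inner_vec_def sum_distrib_right
      sum_distrib_left mult_ac)

text \<open>The matrix factors as the 3x2 matrix with columns \<open>- x\<close>, \<open>u\<close>
  times the transpose of the one with columns \<open>w\<close>, \<open>y\<close>. By Cauchy-Binet
  its 2x2 minors are products of minors of the factors, which are the entries of cross
  products.\<close>

lemma adjugate_outer_diff:
  "adjugate (- outer x w + outer u y) = outer (cross3 y w) (cross3 x u)"
  by (simp add: vec_eq_iff forall_3 adjugate_def transpose_def cofactor_def minor_def
      other_index_def det_2 cross3_def algebra_simps)

lemma det_outer_diff: "det (- outer x w + outer u y) = 0"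
  by (simp add: det_3 algebra_simps)

text \<open>The summand with \<open>w\<close> dies, since \<open>w\<close> is orthogonal to
  \<open>cross3 y' w\<close>. The other one leaves a triple product, permuted cyclically.\<close>

lemma slice_mult_adjugate:
  "(- outer x w + outer u y) ** outer (cross3 y' w) z
    = (cross3 y y' \<bullet> w) *\<^sub>R outer u z"
  by (simp add: vec_eq_iff forall_3 matrix_matrix_mult_def sum_3 cross3_def inner_vec_def
      algebra_simps)

text \<open>Here \<open>u\<close> is orthogonal to \<open>cross3 x' u\<close>, so only the summand
  with \<open>w\<close> survives, with its minus sign. The free \<open>z\<close> covers both an
  adjugate and, with \<open>z\<close> = \<open>u\<close>, a product
  \<open>t l ** a m\<close>.\<close>

lemma adjugate_mult_slice:
  "outer z (cross3 x' u) ** (- outer x w + outer u y)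
    = - ((cross3 x x' \<bullet> u) *\<^sub>R outer z w)"
  by (simp add: vec_eq_iff forall_3 matrix_matrix_mult_def sum_3 cross3_def inner_vec_def
      algebra_simps)

theorem proposition50:
  fixes r s :: "real^3^3" and u w :: "real^3"
    and t a :: "3 \<Rightarrow> real^3^3" and i j k :: 3
  assumes "rotation_matrix r" and "rotation_matrix s"
    and "\<And>l. t l = - outer (column l r) w + outer u (column l s)"
    and "\<And>l. a l = adjugate (t l)"
    and "i \<noteq> j" and "i \<noteq> k" and "j \<noteq> k"
  shows "a i = outer (cross3 (column i s) w) (cross3 (column i r) u)
    \<and> (t i ** a i = det (t i) *\<^sub>R mat 1 \<and> det (t i) *\<^sub>R (mat 1 :: real^3^3) = 0)
    \<and> t i ** a j = (column_wedge s i j \<bullet> w) *\<^sub>R outer u (cross3 (column j r) u)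
    \<and> a j ** t i = - ((column_wedge r i j \<bullet> u) *\<^sub>R outer (cross3 (column j s) w) w)
    \<and> t i ** a j ** t i
        = ((column_wedge s i j \<bullet> w) * (column_wedge r j i \<bullet> u)) *\<^sub>R outer u w
    \<and> t i ** a j ** t k
        = ((column_wedge s i j \<bullet> w) * (column_wedge r j k \<bullet> u)) *\<^sub>R outer u w
    \<and> a i ** t j ** a k = 0"
proof -
  have t: "t l = - outer (column l r) w + outer u (column l s)" for l
    by (rule assms(3))
  have a: "a l = outer (cross3 (column l s) w) (cross3 (column l r) u)" for l
    unfolding assms(4) t by (rule adjugate_outer_diff)
  have ta: "t l ** a m = (column_wedge s l m \<bullet> w) *\<^sub>R outer u (cross3 (column m r) u)" for l m
    unfolding t a column_wedge_def by (rule slice_mult_adjugate)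
  have at: "a m ** t l = - ((column_wedge r l m \<bullet> u) *\<^sub>R outer (cross3 (column m s) w) w)" for l m
    unfolding t a column_wedge_def by (rule adjugate_mult_slice)
  have tat: "t l ** a m ** t n
      = ((column_wedge s l m \<bullet> w) * (column_wedge r m n \<bullet> u)) *\<^sub>R outer u w" for l m n
    \<comment> \<open>Swapping the two columns of \<open>r\<close> absorbs the minus sign from
      \<open>adjugate_mult_slice\<close>. The deleted simp rule would turn \<open>t n\<close> into a
      difference, which that lemma no longer matches.\<close>
    unfolding ta column_wedge_commute[of r m n]
    by (simp add: t adjugate_mult_slice column_wedge_def scalar_matrix_assoc[symmetric]
        del: uminus_add_conv_diff)
  have ata: "a l ** t m ** a n = 0" for l m n
  proof -
    \<comment> \<open>By \<open>at\<close>, \<open>a l ** t m\<close> is a multiple of an outer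
      product ending in \<open>w\<close>, so this inner product is a factor of the whole
      product.\<close>
    have "w \<bullet> cross3 (column n s) w = 0"
      by (simp add: dot_cross_self)
    then have "outer (cross3 (column l s) w) w ** a n = 0"
      by (simp add: a outer_mult_outer)
    then show ?thesis
      unfolding at by (simp add: scalar_matrix_assoc[symmetric] flip: scaleR_minus_left)
  qed
  have det: "det (t i) = 0"
    unfolding t by (rule det_outer_diff)
  have "t i ** a i = det (t i) *\<^sub>R mat 1"
    unfolding assms(4) by (rule matrix_mul_adjugate)
  with det show ?thesis
    using a ta at tat ata by simp
qed

end
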